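(* For all hyper-assertions $P,Q$ and every command $C$, the following are equivalent: (1) $\models\{P\}C\{Q\}$ does not hold; (2) there exists a hyper-assertion $P'$ that is satisfiable (i.e. $P'(S)$ for some set $S$ of extended states), entails $P$ (i.e. $P'(S)\Rightarrow P(S)$ for all $S$), and satisfies $\models\{P'\}C\{\neg Q\}$, where $(\neg Q)(S)$ iff not $Q(S)$.
   Context: Fix sets $\mathit{PVars}$, $\mathit{PVals}$, $\mathit{LVars}$, $\mathit{LVals}$. Program states are total functions $\sigma:\mathit{PVars}\to\mathit{PVals}$. Commands: $C ::= \mathbf{skip} \mid x:=e \mid x:=\mathrm{nonDet}() \mid \mathbf{assume}\ b \mid C;C \mid C+C \mid C^{*}$, with $x\in\mathit{PVars}$, $e$ a total function from program states to $\mathit{PVals}$, $b$ a total function from program states to Booleans. Big-step semantics $\langle C,\sigma\rangle\to\sigma'$ (inductive): $\langle\mathbf{skip},\sigma\rangle\to\sigma$; $\langle x:=e,\sigma\rangle\to\sigma[x\mapsto e(\sigma)]$; $\langle x:=\mathrm{nonDet}(),\sigma\rangle\to\sigma[x\mapsto v]$ for all $v$; $\langle\mathbf{assume}\ b,\sigma\rangle\to\sigma$ if $b(\sigma)$; sequential composition composes executions; $C_1+C_2$ executes either branch; $\langle C^*,\sigma\rangle\to\sigma$, and $\langle C^*,\sigma\rangle\to\sigma''$ whenever $\langle C,\sigma\rangle\to\sigma'$ and $\langle C^*,\sigma'\rangle\to\sigma''$. Extended states are pairs $\varphi=(\varphi^L,\varphi^P)$ with $\varphi^L:\mathit{LVars}\to\mathit{LVals}$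 and $\varphi^P$ a program state; $\mathit{sem}(C,S)=\{\varphi\mid\exists\sigma.(\varphi^L,\sigma)\in S\wedge\langle C,\sigma\rangle\to\varphi^P\}$. A hyper-assertion is a function from sets of extended states to Booleans; $\models\{P\}C\{Q\}$ iff for all sets $S$ of extended states, $P(S)$ implies $Q(\mathit{sem}(C,S))$. *)

theory Defs
  imports Main
begin

type_synonym ('pvar, 'pval) pstate = "'pvar \<Rightarrow> 'pval"

type_synonym ('lvar, 'lval, 'pvar, 'pval) estate =
  "('lvar \<Rightarrow> 'lval) \<times> ('pvar, 'pval) pstate"

type_synonym ('lvar, 'lval, 'pvar, 'pval) hyperassertion =
  "('lvar, 'lval, 'pvar, 'pval) estate set \<Rightarrow> bool"

(* Expressions and guards are arbitrary semantic functions on program states, not syntax. *)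
datatype ('pvar, 'pval) com =
    Skip
  | Assign 'pvar "('pvar, 'pval) pstate \<Rightarrow> 'pval"
  | Havoc 'pvar
  | Assume "('pvar, 'pval) pstate \<Rightarrow> bool"
  | Seq "('pvar, 'pval) com" "('pvar, 'pval) com"
  | Choice "('pvar, 'pval) com" "('pvar, 'pval) com"
  | Iter "('pvar, 'pval) com"

inductive big_step ::
  "('pvar, 'pval) com \<Rightarrow> ('pvar, 'pval) pstate \<Rightarrow> ('pvar, 'pval) pstate \<Rightarrow> bool"
where
  big_step_Skip: "big_step Skip s s"
| big_step_Assign: "big_step (Assign x e) s (s(x := e s))"
| big_step_Havoc: "big_step (Havoc x) s (s(x := v))"
| big_step_Assume: "b s \<Longrightarrow> big_step (Assume b) s s"
| big_step_Seq: "big_step C1 s s' \<Longrightarrow> big_step C2 s' s'' \<Longrightarrow> big_step (Seq C1 C2) s s''"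
| big_step_Choice1: "big_step C1 s s' \<Longrightarrow> big_step (Choice C1 C2) s s'"
| big_step_Choice2: "big_step C2 s s' \<Longrightarrow> big_step (Choice C1 C2) s s'"
| big_step_Iter_refl: "big_step (Iter C) s s"
| big_step_Iter_step: "big_step C s s' \<Longrightarrow> big_step (Iter C) s' s'' \<Longrightarrow> big_step (Iter C) s s''"

definition sem ::
  "('pvar, 'pval) com \<Rightarrow> ('lvar, 'lval, 'pvar, 'pval) estate set
    \<Rightarrow> ('lvar, 'lval, 'pvar, 'pval) estate set"
where
  "sem C S = {\<phi>. \<exists>\<sigma>. (fst \<phi>, \<sigma>) \<in> S \<and> big_step C \<sigma> (snd \<phi>)}"

definition hyper_triple ::
  "('lvar, 'lval, 'pvar, 'pval) hyperassertion \<Rightarrow> ('pvar, 'pval) com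
    \<Rightarrow> ('lvar, 'lval, 'pvar, 'pval) hyperassertion \<Rightarrow> bool"
where
  "hyper_triple P C Q \<longleftrightarrow> (\<forall>S. P S \<longrightarrow> Q (sem C S))"

definition satisfiable :: "('lvar, 'lval, 'pvar, 'pval) hyperassertion \<Rightarrow> bool" where
  "satisfiable P \<longleftrightarrow> (\<exists>S. P S)"

definition entails ::
  "('lvar, 'lval, 'pvar, 'pval) hyperassertion
    \<Rightarrow> ('lvar, 'lval, 'pvar, 'pval) hyperassertion \<Rightarrow> bool"
where
  "entails P Q \<longleftrightarrow> (\<forall>S. P S \<longrightarrow> Q S)"

definition hyper_not ::
  "('lvar, 'lval, 'pvar, 'pval) hyperassertion \<Rightarrow> ('lvar, 'lval, 'pvar, 'pval) hyperassertion"
where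
  "hyper_not Q = (\<lambda>S. \<not> Q S)"

end

theory Submission
  imports Defs
begin

text \<open>A triple fails because of one set \<open>S\<close>, and since hyper-assertions are
  arbitrary predicates on sets, \<open>\<lambda>T. T = S\<close> is a precondition that isolates
  this counterexample. Conversely, any set satisfying \<open>P'\<close> is a counterexample.\<close>

theorem mainTheorem5:
  fixes P Q :: "('lvar, 'lval, 'pvar, 'pval) hyperassertion"
    and C :: "('pvar, 'pval) com"
  shows "(\<not> hyper_triple P C Q) \<longleftrightarrow>
    (\<exists>P' :: ('lvar, 'lval, 'pvar, 'pval) hyperassertion.
       satisfiable P' \<and> entails P' P \<and> hyper_triple P' C (hyper_not Q))"
proof
  assume "\<not> hyper_triple P C Q"
  then obtain S where "P S" and "\<not> Q (sem C S)"
    unfolding hyper_triple_def by blast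
  then have "satisfiable (\<lambda>T. T = S)" and "entails (\<lambda>T. T = S) P"
    and "hyper_triple (\<lambda>T. T = S) C (hyper_not Q)"
    by (simp_all add: satisfiable_def entails_def hyper_triple_def hyper_not_def)
  then show "\<exists>P'. satisfiable P' \<and> entails P' P \<and> hyper_triple P' C (hyper_not Q)"
    by blast
next
  assume "\<exists>P'. satisfiable P' \<and> entails P' P \<and> hyper_triple P' C (hyper_not Q)"
  \<comment> \<open>Satisfiability rules out a vacuous \<open>P'\<close>: at a witness
    \<open>S\<close>, validity of both triples would make \<open>Q (sem C S)\<close> both true and
    false.\<close>
  then show "\<not> hyper_triple P C Q"
    unfolding satisfiable_def entails_def hyper_triple_def hyper_not_def by blast
qed

end
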